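(* Let $(k_n)_{n\ge1}$ be a positive sequence with $\sum_{j\ge1}k_j\le1$, let $a=-\sum_{j\ge1}k_j$, and let $\lambda_n:=\sum_{j\ge n}k_j$ for $n\ge1$, $\lambda_0:=1$. Suppose (C2') $\lambda_n^2\le\lambda_{n-1}\lambda_{n+1}$ for all $n\ge1$ (Kaluza sequence) and (C3') $\lambda_n=L(n)n^{-\alpha}$ with $\alpha\in(0,1)$ and $(L(n))_n$ a slowly varying sequence. Then the discrete resolvent $r$ satisfies $$\lim_{n\to\infty}n^{1-\alpha}L(n)r_n=\frac{\sin(\alpha\pi)}{\pi}.$$
   Context: The discrete resolvent $r=(r_n)_{n\ge0}$ is the unique solution of $r_{n+1}-r_n=ar_n+\sum_{j=1}^nk_jr_{n-j}$ for $n\ge0$, $r_0=1$. A sequence $(c_n)$ of positive numbers is regularly varying of index $\rho$ if $c_{[\lambda n]}/c_n\to\lambda^\rho$ as $n\to\infty$ for every $\lambda>0$ ($[x]$ = integer part); slowly varying means $\rho=0$. *)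

theory Defs
  imports "HOL-Analysis.Analysis"
begin

fun resolvent :: "real \<Rightarrow> (nat \<Rightarrow> real) \<Rightarrow> nat \<Rightarrow> real" where
  "resolvent a k 0 = 1"
| "resolvent a k (Suc n) =
     resolvent a k n + a * resolvent a k n + (\<Sum>j=1..n. k j * resolvent a k (n - j))"

definition tail_lam :: "(nat \<Rightarrow> real) \<Rightarrow> nat \<Rightarrow> real" where
  "tail_lam k n = (if n = 0 then 1 else (\<Sum>j. k (j + n)))"

definition regularly_varying :: "(nat \<Rightarrow> real) \<Rightarrow> real \<Rightarrow> bool" where
  "regularly_varying c \<rho> \<longleftrightarrow> (\<forall>n. c n > 0) \<and>
     (\<forall>l::real. l > 0 \<longrightarrow>
        (\<lambda>n. c (nat \<lfloor>l * real n\<rfloor>) / c n) \<longlonglongrightarrow> l powr \<rho>)"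

definition slowly_varying :: "(nat \<Rightarrow> real) \<Rightarrow> bool" where
  "slowly_varying c \<longleftrightarrow> regularly_varying c 0"

end

theory Submission
  imports Defs "HOL-Real_Asymp.Real_Asymp"
begin

text \<open>Write \<open>\<lambda>\<close> for the tail sequence. The resolvent equation says that the convolution of
  \<open>\<lambda>\<close> and \<open>r\<close> is constantly 1, and Kaluza's theorem then makes \<open>r\<close> nonnegative and decreasing.
  With \<open>S\<close> and \<open>R\<close> the Laplace transforms of \<open>\<lambda>\<close> and \<open>r\<close>, the convolution identity reads
  \<open>S x * R x = 1 / (1 - exp (- x))\<close>. Dominated convergence with a Potter bound gives
  \<open>S (s / n) / (n * \<lambda> n) \<longlonglongrightarrow> Gamma (1 - \<alpha>) * s powr (\<alpha> - 1)\<close>, hence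
  \<open>\<lambda> n * R (s / n) \<longlonglongrightarrow> s powr (- \<alpha>) / Gamma (1 - \<alpha>)\<close>. By Karamata's argument (Weierstrass
  approximation in the variable \<open>exp (- t)\<close>) the measures with mass \<open>\<lambda> n * r j\<close> at \<open>j / n\<close> converge
  weakly to \<open>t powr (\<alpha> - 1) / (Gamma \<alpha> * Gamma (1 - \<alpha>)) dt\<close>. Testing with bumps supported just
  to the right or left of 1, monotonicity of \<open>r\<close> yields the limit of \<open>n * \<lambda> n * r n\<close>, and the
  reflection formula identifies the constant.\<close>

section \<open>Kaluza sequences\<close>

text \<open>Raising \<open>n\<close> by one leaves the convolution unchanged: after an index shift
  the \<open>lam (Suc j)\<close> terms cancel against those in \<open>rec\<close>. Applied to the
  resolvent equation, whose coefficients are the decrements of the tail sequence.\<close>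

lemma convolution_eq_one:
  fixes lam r :: "nat \<Rightarrow> real"
  assumes "lam 0 = 1" "r 0 = 1"
    and rec: "\<And>n. r (Suc n) = (\<Sum>j\<le>n. (lam j - lam (Suc j)) * r (n - j))"
  shows "(\<Sum>j\<le>n. lam j * r (n - j)) = 1"
proof (induction n)
  case 0
  then show ?case using assms by simp
next
  case (Suc n)
  have "(\<Sum>j\<le>Suc n. lam j * r (Suc n - j)) = r (Suc n) + (\<Sum>j\<le>n. lam (Suc j) * r (n - j))"
    using assms(1) by (subst sum.atMost_Suc_shift) simp
  also have "\<dots> = (\<Sum>j\<le>n. lam j * r (n - j))"
    by (simp add: rec left_diff_distrib sum_subtractf)
  finally show ?case using Suc by simp
qed

lemma kaluza_ratio_mono:
  fixes lam :: "nat \<Rightarrow> real"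
  assumes pos: "\<And>n. lam n > 0"
    and kaluza: "\<And>n. (lam (Suc n))\<^sup>2 \<le> lam n * lam (Suc (Suc n))"
    and "i \<le> n"
  shows "lam (Suc i) / lam i \<le> lam (Suc n) / lam n"
proof -
  have "lam (Suc n) / lam n \<le> lam (Suc (Suc n)) / lam (Suc n)" for n
    using kaluza[of n] pos[of n] pos[of "Suc n"]
    by (simp add: field_simps power2_eq_square)
  then show ?thesis
    using \<open>i \<le> n\<close> by (rule lift_Suc_mono_le)
qed

text \<open>Difference of the convolution identities at \<open>n\<close> and \<open>Suc n\<close>:
  the term with \<open>r 0\<close> in the latter has no partner and becomes the right-hand
  side.\<close>

lemma kaluza_decrements:
  fixes lam r :: "nat \<Rightarrow> real"
  assumes r0: "r 0 = 1"
    and conv: "\<And>n. (\<Sum>i\<le>n. r i * lam (n - i)) = 1"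
  shows "(\<Sum>i\<le>n. (r i - r (Suc i)) * lam (n - i)) = lam (Suc n)"
proof -
  have "1 = lam (Suc n) + (\<Sum>i\<le>n. r (Suc i) * lam (n - i))"
    using conv[of "Suc n"] r0 by (subst (asm) sum.atMost_Suc_shift) simp
  then show ?thesis
    using conv[of n] by (simp add: left_diff_distrib sum_subtractf)
qed

text \<open>Kaluza's argument: multiplying the identity for \<open>lam (m + 1)\<close> by the ratio
  \<open>lam (m + 2) / lam (m + 1)\<close>, which dominates all earlier ratios, bounds the first
  \<open>m + 1\<close> terms of the identity for \<open>lam (m + 2)\<close> and leaves a nonnegative last term.\<close>

lemma kaluza_decseq:
  fixes lam r :: "nat \<Rightarrow> real"
  assumes lam0: "lam 0 = 1" and r0: "r 0 = 1"
    and pos: "\<And>n. lam n > 0"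
    and kaluza: "\<And>n. (lam (Suc n))\<^sup>2 \<le> lam n * lam (Suc (Suc n))"
    and conv: "\<And>n. (\<Sum>i\<le>n. r i * lam (n - i)) = 1"
  shows "decseq r"
proof -
  define p where "p i = r i - r (Suc i)" for i
  have p: "(\<Sum>i\<le>n. p i * lam (n - i)) = lam (Suc n)" for n
    unfolding p_def by (rule kaluza_decrements[OF r0 conv])
  have "p n \<ge> 0" for n
  proof (induction n rule: less_induct)
    case (less n)
    show ?case
    proof (cases n)
      case 0
      then show ?thesis using p[of 0] lam0 pos[of 1] by simp
    next
      case (Suc m)
      define q where "q = lam (Suc (Suc m)) / lam (Suc m)"
      have "(\<Sum>i\<le>m. p i * lam (Suc m - i)) \<le> (\<Sum>i\<le>m. p i * (q * lam (m - i)))"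
      proof (intro sum_mono mult_left_mono)
        fix i assume i: "i \<in> {..m}"
        have "lam (Suc (m - i)) / lam (m - i) \<le> q"
          unfolding q_def by (rule kaluza_ratio_mono[of lam, OF pos kaluza]) simp
        then show "lam (Suc m - i) \<le> q * lam (m - i)"
          using pos[of "m - i"] i by (simp add: field_simps Suc_diff_le)
        show "p i \<ge> 0" using less i Suc by simp
      qed
      also have "\<dots> = q * (\<Sum>i\<le>m. p i * lam (m - i))"
        by (simp add: sum_distrib_left algebra_simps)
      also have "\<dots> = lam (Suc (Suc m))"
        unfolding p q_def using pos[of "Suc m"] by simp
      finally show ?thesis using p[of "Suc m"] lam0 Suc by simp
    qed
  qed
  then show ?thesis unfolding p_def by (intro decseq_SucI) simp
qed

text \<open>Replacing every \<open>lam (m - i)\<close> in the decrement identity by the smaller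
  \<open>lam (Suc m)\<close> makes the sum telescope, which leaves
  \<open>1 - r (Suc m) \<le> 1\<close> after division by \<open>lam (Suc m)\<close>.\<close>

lemma kaluza_nonneg:
  fixes lam r :: "nat \<Rightarrow> real"
  assumes r0: "r 0 = 1"
    and pos: "\<And>n. lam n > 0" and "decseq lam" and "decseq r"
    and conv: "\<And>n. (\<Sum>i\<le>n. r i * lam (n - i)) = 1"
  shows "r n \<ge> 0"
proof (cases n)
  case (Suc m)
  have "lam (Suc m) * (1 - r (Suc m)) = (\<Sum>i\<le>m. (r i - r (Suc i)) * lam (Suc m))"
    using r0 by (simp add: sum_telescope flip: sum_distrib_right)
  also have "\<dots> \<le> (\<Sum>i\<le>m. (r i - r (Suc i)) * lam (m - i))"
    using \<open>decseq lam\<close> \<open>decseq r\<close>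
    by (intro sum_mono mult_left_mono) (auto simp: decseq_def)
  also have "\<dots> = lam (Suc m)"
    by (rule kaluza_decrements[OF r0 conv])
  finally show ?thesis using pos[of "Suc m"] Suc by (simp add: right_diff_distrib zero_le_mult_iff)
qed (simp add: r0)

section \<open>The Abelian theorem\<close>

lemma nat_floor_half: "nat \<lfloor>1 / 2 * real n\<rfloor> = n div 2"
  by linarith

text \<open>Iterated halving. For large \<open>n\<close>, passing from \<open>n div 2\<close> to
  \<open>n\<close> does not decrease \<open>lam n * (real n + 1) powr \<beta>\<close>, since the
  quotient is bounded by a sequence tending to \<open>(1/2) powr (\<beta> - \<alpha>) < 1\<close>.
  Hence the constant does not grow along the induction.\<close>

lemma potter_bound:
  assumes rv: "regularly_varying lam (-\<alpha>)" and dec: "decseq lam" and "\<alpha> < \<beta>" "0 < \<beta>"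
  obtains C where "C > 0"
    "\<And>j n. j \<le> n \<Longrightarrow> lam j * (real j + 1) powr \<beta> \<le> C * (lam n * (real n + 1) powr \<beta>)"
proof -
  have pos: "lam n > 0" for n using rv by (auto simp: regularly_varying_def)
  have lim: "(\<lambda>n. lam (n div 2) / lam n) \<longlonglongrightarrow> (1/2) powr (-\<alpha>)"
    using rv[unfolded regularly_varying_def, THEN conjunct2, rule_format, of "1/2"]
    unfolding nat_floor_half by simp
  \<comment> \<open>This fraction bounds \<open>(real (n div 2) + 1) / (real n + 1)\<close> from
    above for either parity of \<open>n\<close>.\<close>
  have "(\<lambda>n. (real n + 2) / (2 * (real n + 1))) \<longlonglongrightarrow> 1/2"
    by real_asymp
  then have "(\<lambda>n. lam (n div 2) / lam n * ((real n + 2) / (2 * (real n + 1))) powr \<beta>)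
      \<longlonglongrightarrow> (1/2) powr (-\<alpha>) * (1/2) powr \<beta>"
    by (intro tendsto_mult tendsto_powr tendsto_const lim) auto
  also have "(1/2) powr (-\<alpha>) * (1/2) powr \<beta> = (1/2::real) powr (\<beta> - \<alpha>)"
    by (simp flip: powr_add)
  finally have "eventually (\<lambda>n. lam (n div 2) / lam n *
      ((real n + 2) / (2 * (real n + 1))) powr \<beta> < 1) sequentially"
    using powr_less_mono'[of "1/2" 0 "\<beta> - \<alpha>"] \<open>\<alpha> < \<beta>\<close> by (elim order_tendstoD(2)) simp
  moreover define D :: real where "D = (1/2) powr (-\<alpha>) + 1"
  have "eventually (\<lambda>n. lam (n div 2) / lam n < D) sequentially"
    using lim by (elim order_tendstoD(2)) (simp add: D_def)
  ultimately have "eventually (\<lambda>n. lam (n div 2) / lam n < D \<and> lam (n div 2) / lam n *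
      ((real n + 2) / (2 * (real n + 1))) powr \<beta> < 1) sequentially"
    by eventually_elim auto
  then obtain N0 where N0: "\<And>n. n \<ge> N0 \<Longrightarrow> lam (n div 2) / lam n < D"
      "\<And>n. n \<ge> N0 \<Longrightarrow> lam (n div 2) / lam n * ((real n + 2) / (2 * (real n + 1))) powr \<beta> < 1"
    by (auto simp: eventually_sequentially)
  \<comment> \<open>The successor makes \<open>N\<close> positive, so that
    \<open>n div 2 < n\<close> for \<open>n \<ge> N\<close> and the induction can descend.
    \<open>C0\<close> divides the largest left side for indices below \<open>N\<close> by
    \<open>lam N\<close>, a lower bound for the right side there.\<close>
  define N where "N = Suc N0"
  define C0 where "C0 = lam 0 * (real N + 1) powr \<beta> / lam N"
  have "D > 0" by (simp add: D_def add_pos_pos)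
  have "C0 > 0" using pos by (simp add: C0_def)
  define C where "C = C0 + D"
  have "C > 0" using \<open>C0 > 0\<close> \<open>D > 0\<close> by (simp add: C_def)
  have "lam j * (real j + 1) powr \<beta> \<le> C * (lam n * (real n + 1) powr \<beta>)" if "j \<le> n" for j n
    using that
  proof (induction n arbitrary: j rule: less_induct)
    case (less n)
    have G: "lam n * (real n + 1) powr \<beta> > 0" using pos by simp
    \<comment> \<open>Small \<open>n\<close> are absorbed by \<open>C0\<close>. In the upper half
      monotonicity of \<open>lam\<close> loses at most \<open>D\<close>. Below it the induction
      hypothesis at \<open>n div 2\<close> is used with the same \<open>C\<close>.\<close>
    consider "n < N" | "n \<ge> N" "j \<ge> n div 2" | "n \<ge> N" "j < n div 2" by linarith
    then show ?case
    proof cases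
      case 1
      have "lam j * (real j + 1) powr \<beta> \<le> lam 0 * (real N + 1) powr \<beta>"
        using less.prems 1 dec \<open>0 < \<beta>\<close> pos[of 0]
        by (intro mult_mono powr_mono2) (auto simp: decseq_def)
      also have "\<dots> = C0 * (lam N * 1)" using pos[of N] by (simp add: C0_def)
      also have "\<dots> \<le> C * (lam n * (real n + 1) powr \<beta>)"
        using 1 dec pos[of N] pos[of n] \<open>C0 > 0\<close> \<open>D > 0\<close> \<open>0 < \<beta>\<close>
        by (intro mult_mono ge_one_powr_ge_zero) (auto simp: decseq_def C_def)
      finally show ?thesis .
    next
      case 2
      have "lam j \<le> lam (n div 2)" using 2 dec by (auto simp: decseq_def)
      also have "\<dots> \<le> D * lam n"
        using N0(1)[of n] 2 pos[of n] by (simp add: N_def field_simps)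
      also have "\<dots> \<le> C * lam n"
        using \<open>C0 > 0\<close> pos[of n] by (simp add: C_def)
      finally have "lam j * (real j + 1) powr \<beta> \<le> (C * lam n) * (real n + 1) powr \<beta>"
        using less.prems pos[of n] \<open>C > 0\<close> \<open>0 < \<beta>\<close> by (intro mult_mono powr_mono2) auto
      then show ?thesis by (simp add: mult.assoc)
    next
      case 3
      have "lam j * (real j + 1) powr \<beta> \<le> C * (lam (n div 2) * (real (n div 2) + 1) powr \<beta>)"
        using 3 by (intro less.IH) (auto simp: N_def)
      also have "\<dots> \<le> C * (lam n * (real n + 1) powr \<beta>)"
      proof (rule mult_left_mono)
        have "real (n div 2) + 1 \<le> (real n + 2) / 2"
          using of_nat_mono[of "n div 2 * 2" n, where 'a=real] by simp
        also have "\<dots> = (real n + 2) / (2 * (real n + 1)) * (real n + 1)"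
          using nonzero_mult_divide_mult_cancel_right[of "real n + 1" "real n + 2" 2]
          by (simp only: times_divide_eq_left)
        finally have "real (n div 2) + 1 \<le> (real n + 2) / (2 * (real n + 1)) * (real n + 1)" .
        then have "(real (n div 2) + 1) powr \<beta>
            \<le> ((real n + 2) / (2 * (real n + 1)) * (real n + 1)) powr \<beta>"
          using \<open>0 < \<beta>\<close> by (intro powr_mono2) auto
        also have "\<dots> = ((real n + 2) / (2 * (real n + 1))) powr \<beta> * (real n + 1) powr \<beta>"
          by (rule powr_mult)
        finally have "lam (n div 2) * (real (n div 2) + 1) powr \<beta>
            \<le> lam (n div 2) * (((real n + 2) / (2 * (real n + 1))) powr \<beta> * (real n + 1) powr \<beta>)"
          using pos[of "n div 2"] by simp
        also have "\<dots> = (lam (n div 2) / lam n * ((real n + 2) / (2 * (real n + 1))) powr \<beta>)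
            * (lam n * (real n + 1) powr \<beta>)"
          using pos[of n] by simp
        also have "\<dots> \<le> 1 * (lam n * (real n + 1) powr \<beta>)"
          using N0(2)[of n] 3 G by (intro mult_right_mono) (auto simp: N_def)
        finally show "lam (n div 2) * (real (n div 2) + 1) powr \<beta> \<le> lam n * (real n + 1) powr \<beta>"
          by simp
      qed (use \<open>C > 0\<close> in simp)
      finally show ?thesis .
    qed
  qed
  with \<open>C > 0\<close> show ?thesis by (rule that)
qed

section \<open>Laplace sums as integrals of step functions, and their scaling limit\<close>

lemma has_bochner_integral_step_function:
  fixes g :: "nat \<Rightarrow> real"
  assumes g: "\<And>j. g j \<ge> 0" "summable g" and n: "n > 0"
  shows "has_bochner_integral lborel (\<lambda>t. indicator {0..} t * g (nat \<lfloor>t * real n\<rfloor>))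
           ((\<Sum>j. g j) / real n)"
proof (rule has_bochner_integral_nn_integral)
  \<comment> \<open>Exactly one interval of the partition into pieces of length \<open>1 / n\<close>
    contains \<open>t\<close>, so at most one term of the series survives.\<close>
  have eq: "ennreal (indicator {0..} t * g (nat \<lfloor>t * real n\<rfloor>)) =
      (\<Sum>j. ennreal (g j) * indicator {real j / n..<(real j + 1) / n} t)" for t
  proof (cases "t \<ge> 0")
    case True
    have j_iff: "t \<in> {real j / n..<(real j + 1) / n} \<longleftrightarrow> j = nat \<lfloor>t * real n\<rfloor>" for j
    proof -
      have "t \<in> {real j / n..<(real j + 1) / n} \<longleftrightarrow> real j \<le> t * n \<and> t * n < real j + 1"
        using n by (simp add: field_simps)
      also have "\<dots> \<longleftrightarrow> \<lfloor>t * real n\<rfloor> = int j"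
        by (auto simp: floor_eq_iff)
      also have "\<dots> \<longleftrightarrow> j = nat \<lfloor>t * real n\<rfloor>"
        using True by auto
      finally show ?thesis .
    qed
    have "(\<Sum>j. ennreal (g j) * indicator {real j / n..<(real j + 1) / n} t)
        = (\<Sum>j\<in>{nat \<lfloor>t * real n\<rfloor>}. ennreal (g j) * indicator {real j / n..<(real j + 1) / n} t)"
      unfolding indicator_def j_iff by (intro suminf_finite) auto
    also have "\<dots> = ennreal (g (nat \<lfloor>t * real n\<rfloor>))"
      unfolding indicator_def j_iff by simp
    finally show ?thesis using True by simp
  next
    case False
    have "indicator {real j / n..<(real j + 1) / n} t = (0::ennreal)" for j
      using False n order_trans[of 0 "real j / n" t] by (auto simp: indicator_def)
    with False show ?thesis by simp
  qed
  have "(\<integral>\<^sup>+t. ennreal (indicator {0..} t * g (nat \<lfloor>t * real n\<rfloor>)) \<partial>lborel) =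
      (\<Sum>j. \<integral>\<^sup>+t. ennreal (g j) * indicator {real j / n..<(real j + 1) / n} t \<partial>lborel)"
    unfolding eq by (rule nn_integral_suminf) simp
  also have "\<dots> = (\<Sum>j. ennreal (g j / n))"
  proof (rule suminf_cong)
    fix j
    have "(\<integral>\<^sup>+t. ennreal (g j) * indicator {real j / n..<(real j + 1) / n} t \<partial>lborel) =
        ennreal (g j) * ennreal ((real j + 1) / n - real j / n)"
      by (subst nn_integral_cmult_indicator) (simp_all add: divide_right_mono)
    also have "\<dots> = ennreal (g j / n)"
      using g(1)[of j] by (simp add: ennreal_mult' [symmetric] flip: diff_divide_distrib)
    finally show "(\<integral>\<^sup>+t. ennreal (g j) * indicator {real j / n..<(real j + 1) / n} t \<partial>lborel)
        = ennreal (g j / n)" .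
  qed
  also have "\<dots> = ennreal (\<Sum>j. g j / n)"
    using g by (intro suminf_ennreal2 summable_divide) auto
  also have "(\<Sum>j. g j / n) = (\<Sum>j. g j) / n"
    using g(2) by (rule suminf_divide)
  finally show "(\<integral>\<^sup>+t. ennreal (indicator {0..} t * g (nat \<lfloor>t * real n\<rfloor>)) \<partial>lborel)
      = ennreal ((\<Sum>j. g j) / n)" .
qed (use g in \<open>auto intro!: divide_nonneg_nonneg suminf_nonneg\<close>)

text \<open>Euler's integral after the substitution \<open>s * t\<close>. It evaluates limit
  integrals and, with exponents \<open>1 - \<beta>\<close> and \<open>1\<close>, gives integrability
  of the dominating function below.\<close>

lemma has_bochner_integral_Gamma:
  fixes a s :: real
  assumes a: "a > 0" and s: "s > 0"
  shows "has_bochner_integral lborel (\<lambda>t. indicator {0..} t * t powr (a - 1) * exp (- (s * t)))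
           (Gamma a * s powr (- a))"
proof -
  define f where "f t = indicator {0..} t * t powr (a - 1) * exp (- t)" for t :: real
  have "has_bochner_integral lborel f (Gamma a)"
  proof (rule has_bochner_integral_nn_integral)
    show "(\<integral>\<^sup>+t. ennreal (f t) \<partial>lborel) = ennreal (Gamma a)"
      unfolding Gamma_conv_nn_integral_real[OF a] f_def by (simp add: exp_minus field_simps)
    show "Gamma a \<ge> 0" using Gamma_real_pos[OF a] by simp
    show "f \<in> borel_measurable lborel" unfolding f_def by measurable
  qed (auto simp: f_def)
  then have "has_bochner_integral lborel (\<lambda>t. f (s * t)) (Gamma a / s)"
    using s by (subst (asm) lborel_has_bochner_integral_real_affine_iff[of s _ _ 0])
      (auto simp: divide_inverse mult.commute)
  then have "has_bochner_integral lborel (\<lambda>t. s powr (1 - a) * f (s * t))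
      (s powr (1 - a) * (Gamma a / s))"
    by (rule has_bochner_integral_mult_right)
  also have "s powr (1 - a) * (Gamma a / s) = Gamma a * s powr (- a)"
    using s by (simp add: powr_diff powr_minus field_simps)
  also have "(\<lambda>t. s powr (1 - a) * f (s * t)) =
      (\<lambda>t. indicator {0..} t * t powr (a - 1) * exp (- (s * t)))"
  proof
    fix t
    have "s powr (1 - a) * s powr (a - 1) = 1"
      using s by (simp flip: powr_add)
    then show "s powr (1 - a) * f (s * t) = indicator {0..} t * t powr (a - 1) * exp (- (s * t))"
      using s by (cases "t \<ge> 0") (simp_all add: f_def powr_mult indicator_def zero_le_mult_iff)
  qed
  finally show ?thesis .
qed

lemma summable_bounded_mult_exp:
  fixes c :: "nat \<Rightarrow> real"
  assumes "\<And>j. \<bar>c j\<bar> \<le> B" "x > 0"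
  shows "summable (\<lambda>j. c j * exp (- (x * real j)))"
proof (rule summable_comparison_test')
  show "summable (\<lambda>j. B * exp (- x) ^ j)"
    using \<open>x > 0\<close> by (intro summable_mult summable_geometric) simp
  show "norm (c j * exp (- (x * real j))) \<le> B * exp (- x) ^ j" if "j \<ge> 0" for j
    using assms(1)[of j]
    by (auto simp: abs_mult mult.commute[of x] simp flip: exp_of_nat_mult intro!: mult_right_mono)
qed

lemma tendsto_floor_over:
  fixes t :: real
  assumes "t \<ge> 0"
  shows "(\<lambda>n. real (nat \<lfloor>t * real n\<rfloor>) / real n) \<longlonglongrightarrow> t"
proof (rule tendsto_sandwich)
  show "(\<lambda>n. t - 1 / real n) \<longlonglongrightarrow> t" by real_asymp
  show "\<forall>\<^sub>F n in sequentially. t - 1 / real n \<le> real (nat \<lfloor>t * real n\<rfloor>) / real n"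
    using eventually_gt_at_top[of 0]
  proof eventually_elim
    case (elim n)
    have "t * real n - 1 \<le> real (nat \<lfloor>t * real n\<rfloor>)" by linarith
    then have "(t * real n - 1) / real n \<le> real (nat \<lfloor>t * real n\<rfloor>) / real n"
      by (rule divide_right_mono) simp
    then show ?case using elim by (simp add: diff_divide_distrib)
  qed
  show "\<forall>\<^sub>F n in sequentially. real (nat \<lfloor>t * real n\<rfloor>) / real n \<le> t"
    using eventually_gt_at_top[of 0]
  proof eventually_elim
    case (elim n)
    have "real (nat \<lfloor>t * real n\<rfloor>) \<le> t * real n" using assms by simp
    then show ?case using elim by (simp add: field_simps)
  qed
qed simp

lemma abelian_regularly_varying:
  assumes rv: "regularly_varying lam (-\<alpha>)" and dec: "decseq lam" and \<alpha>: "0 < \<alpha>" "\<alpha> < 1"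
    and s: "s > 0"
  shows "(\<lambda>n. (\<Sum>j. lam j * exp (- (s / real n * real j))) / (real n * lam n))
           \<longlonglongrightarrow> Gamma (1 - \<alpha>) * s powr (\<alpha> - 1)"
proof -
  have pos: "lam n > 0" for n using rv by (auto simp: regularly_varying_def)
  \<comment> \<open>Midway between \<alpha> and 1: above \<alpha> for the Potter bound, below 1 so
    that \<open>t powr (- \<beta>)\<close> is integrable near 0.\<close>
  define \<beta> where "\<beta> = (1 + \<alpha>) / 2"
  have \<beta>: "\<alpha> < \<beta>" "0 < \<beta>" "\<beta> < 1" using \<alpha> by (auto simp: \<beta>_def)
  obtain C where C: "C > 0"
    "\<And>j n. j \<le> n \<Longrightarrow> lam j * (real j + 1) powr \<beta> \<le> C * (lam n * (real n + 1) powr \<beta>)"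
    using potter_bound[OF rv dec \<beta>(1,2)] by blast
  define F where "F n t = indicator {0..} t *
      (lam (nat \<lfloor>t * real n\<rfloor>) / lam n * exp (- (s / real n * real (nat \<lfloor>t * real n\<rfloor>))))" for n t
  define G where "G t = indicator {0..} t * t powr ((1 - \<alpha>) - 1) * exp (- (s * t))" for t :: real
  \<comment> \<open>With \<open>j\<close> the integer part of \<open>t * n\<close>, the first
    summand is the Potter bound for \<open>j \<le> n\<close>, using
    \<open>n + 1 \<le> 2 * n\<close>. The second covers \<open>j > n\<close>, where
    \<open>lam j \<le> lam n\<close>. The factor \<open>exp s\<close> pays for replacing
    \<open>j / n\<close> by \<open>t\<close>, as the exponent changes by at most
    \<open>s / n \<le> s\<close>.\<close>
  define W where "W t = exp s * (C * 2 powr \<beta> *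
      (indicator {0..} t * t powr ((1 - \<beta>) - 1) * exp (- (s * t))) +
      indicator {0..} t * t powr (1 - 1) * exp (- (s * t)))" for t :: real
  have F: "has_bochner_integral lborel (F n)
      ((\<Sum>j. lam j * exp (- (s / real n * real j))) / (real n * lam n))" if "n > 0" for n
  proof -
    have sm: "summable (\<lambda>j. lam j * exp (- (s / real n * real j)))"
      using pos dec that s
      by (intro summable_bounded_mult_exp[of _ "lam 0"]) (auto simp: decseq_def abs_of_pos)
    have "has_bochner_integral lborel
        (\<lambda>t. indicator {0..} t * (lam (nat \<lfloor>t * real n\<rfloor>) * exp (- (s / real n * real (nat \<lfloor>t * real n\<rfloor>)))))
        ((\<Sum>j. lam j * exp (- (s / real n * real j))) / real n)"
      using pos sm that by (intro has_bochner_integral_step_function) (auto simp: less_imp_le)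
    from has_bochner_integral_divide_zero[OF this, of "lam n"]
    show ?thesis unfolding F_def by (simp add: mult.assoc)
  qed
  \<comment> \<open>The point 0 must be left out: \<open>0 powr x = 0\<close> makes
    \<open>W 0\<close> vanish, while \<open>F n 0\<close> is positive. A single point is a null
    set.\<close>
  have bound: "norm (F n t) \<le> W t" if n: "n > 0" and t: "t \<noteq> 0" for n t
  proof (cases "t > 0")
    case True
    define j where "j = nat \<lfloor>t * real n\<rfloor>"
    have j: "real j \<le> t * n" "t * n < real j + 1"
      using True unfolding j_def by (simp, linarith)
    have "exp (- (s / real n * real j)) \<le> exp (s - s * t)"
    proof -
      have "t * n - 1 \<le> real j" using j by simp
      then have "(t * n - 1) * (s / n) \<le> real j * (s / n)" using s by (intro mult_right_mono) auto
      moreover have "(t * n - 1) * (s / n) = s * t - s / n" using n by (simp add: field_simps)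
      moreover have "s / n \<le> s" using n s by (simp add: field_simps)
      ultimately have "s * t - s \<le> real j * (s / n)" by linarith
      then show ?thesis by (simp add: mult.commute)
    qed
    moreover have "lam j / lam n \<le> C * 2 powr \<beta> * t powr (- \<beta>) + 1"
    proof (cases "j \<le> n")
      case True
      have tn: "t * n > 0" using \<open>t > 0\<close> n by simp
      have "lam j \<le> C * (lam n * (real n + 1) powr \<beta>) / (real j + 1) powr \<beta>"
        using C(2)[OF True] by (simp add: field_simps)
      then have "lam j / lam n \<le> C * (real n + 1) powr \<beta> / (real j + 1) powr \<beta>"
        using pos[of n] by (simp add: field_simps)
      also have "\<dots> \<le> C * (2 * real n) powr \<beta> / (t * n) powr \<beta>"
        using C(1) n j tn \<beta> by (intro frac_le mult_left_mono powr_mono2) auto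
      also have "\<dots> = C * 2 powr \<beta> * t powr (- \<beta>)"
        using n \<open>t > 0\<close> by (simp add: powr_mult powr_minus field_simps)
      finally show ?thesis by simp
    next
      case False
      then have "lam j \<le> lam n" using dec by (simp add: decseq_def)
      then have "lam j / lam n \<le> 1" using pos[of n] by simp
      moreover have "C * 2 powr \<beta> * t powr (- \<beta>) \<ge> 0" using C(1) by simp
      ultimately show ?thesis by linarith
    qed
    ultimately have "lam j / lam n * exp (- (s / real n * real j))
        \<le> (C * 2 powr \<beta> * t powr (- \<beta>) + 1) * exp (s - s * t)"
      using pos[of j] pos[of n] C(1) by (intro mult_mono) auto
    moreover have "norm (F n t) = lam j / lam n * exp (- (s / real n * real j))"
      using True pos[of j] pos[of n] by (simp add: F_def j_def abs_mult less_imp_le)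
    moreover have "W t = (C * 2 powr \<beta> * t powr (- \<beta>) + 1) * exp (s - s * t)"
      using True by (simp add: W_def exp_diff exp_minus field_simps)
    ultimately show ?thesis by simp
  next
    case False
    with t show ?thesis by (simp add: F_def W_def)
  qed
  have lim: "(\<lambda>n. F n t) \<longlonglongrightarrow> G t" if "t \<noteq> 0" for t
  proof (cases "t > 0")
    case True
    have "(\<lambda>n. lam (nat \<lfloor>t * real n\<rfloor>) / lam n *
        exp (- (s * (real (nat \<lfloor>t * real n\<rfloor>) / real n)))) \<longlonglongrightarrow> t powr (- \<alpha>) * exp (- (s * t))"
      using True rv by (intro tendsto_intros tendsto_floor_over) (auto simp: regularly_varying_def)
    then show ?thesis using True by (simp add: F_def G_def)
  qed (use that in \<open>simp add: F_def G_def\<close>)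
  have G: "has_bochner_integral lborel G (Gamma (1 - \<alpha>) * s powr (- (1 - \<alpha>)))"
    unfolding G_def using \<alpha> s by (intro has_bochner_integral_Gamma) auto
  \<comment> \<open>The domination has to hold at every index, so the sequence starts at
    \<open>n = 1\<close> and is shifted back at the end.\<close>
  have "(\<lambda>n. integral\<^sup>L lborel (F (Suc n))) \<longlonglongrightarrow> integral\<^sup>L lborel G"
  proof (rule integral_dominated_convergence)
    show "G \<in> borel_measurable lborel"
      using G by (auto simp: has_bochner_integral_iff)
    show "F (Suc n) \<in> borel_measurable lborel" for n
      using F[of "Suc n"] by (auto simp: has_bochner_integral_iff)
    show "integrable lborel W"
      unfolding W_def using \<beta> s
      by (intro integrable_mult_right Bochner_Integration.integrable_add
          integrable.intros[OF has_bochner_integral_Gamma]) auto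
    show "AE t in lborel. (\<lambda>n. F (Suc n) t) \<longlonglongrightarrow> G t"
      using AE_lborel_singleton[of 0] by eventually_elim (use lim in \<open>auto intro: LIMSEQ_Suc\<close>)
    show "AE t in lborel. norm (F (Suc n) t) \<le> W t" for n
      using AE_lborel_singleton[of 0] by eventually_elim (use bound in auto)
  qed
  moreover have "integral\<^sup>L lborel (F (Suc n)) =
      (\<Sum>j. lam j * exp (- (s / real (Suc n) * real j))) / (real (Suc n) * lam (Suc n))" for n
    using F[of "Suc n"] by (simp add: has_bochner_integral_integral_eq)
  moreover have "integral\<^sup>L lborel G = Gamma (1 - \<alpha>) * s powr (\<alpha> - 1)"
    using G by (simp add: has_bochner_integral_integral_eq)
  ultimately have "(\<lambda>n. (\<Sum>j. lam j * exp (- (s / real (Suc n) * real j))) /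
      (real (Suc n) * lam (Suc n))) \<longlonglongrightarrow> Gamma (1 - \<alpha>) * s powr (\<alpha> - 1)"
    by (simp only:)
  then show ?thesis by (rule filterlim_sequentially_Suc[THEN iffD1])
qed

section \<open>The Tauberian theorem\<close>

lemma bounded_on_unit_interval:
  assumes "continuous_on UNIV (f :: real \<Rightarrow> real)"
  obtains B where "\<And>x. x \<in> {0..1} \<Longrightarrow> \<bar>f x\<bar> \<le> B"
proof -
  have "compact (f ` {0..1})"
    using assms by (intro compact_continuous_image) (auto intro: continuous_on_subset)
  then have "bounded (f ` {0..1})" by (rule compact_imp_bounded)
  then obtain B where "\<forall>y \<in> f ` {0..1}. norm y \<le> B" unfolding bounded_iff by blast
  then have "\<And>x. x \<in> {0..1} \<Longrightarrow> \<bar>f x\<bar> \<le> B" by (metis imageI real_norm_def)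
  then show ?thesis by (rule that)
qed

lemma integrable_mult_continuous_compose:
  assumes u: "integrable M u" and y: "y \<in> borel_measurable M" "\<And>t. y t \<in> {0..1::real}"
    and f: "continuous_on UNIV (f :: real \<Rightarrow> real)"
  shows "integrable M (\<lambda>t. u t * f (y t))"
proof -
  obtain B where B: "\<And>x. x \<in> {0..1} \<Longrightarrow> \<bar>f x\<bar> \<le> B"
    using bounded_on_unit_interval[OF f] by blast
  have [measurable]: "f \<in> borel_measurable borel" "y \<in> borel_measurable M" "u \<in> borel_measurable M"
    using f y u by (auto intro: borel_measurable_continuous_onI)
  show ?thesis
  proof (rule Bochner_Integration.integrable_bound)
    show "integrable M (\<lambda>t. B * u t)" using u by simp
    show "AE t in M. norm (u t * f (y t)) \<le> norm (B * u t)"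
    proof (rule AE_I2)
      fix t
      have "\<bar>f (y t)\<bar> \<le> \<bar>B\<bar>" using B[OF y(2)[of t]] by linarith
      then show "norm (u t * f (y t)) \<le> norm (B * u t)"
        by (simp add: abs_mult mult.commute[of "\<bar>u t\<bar>"] mult_right_mono)
    qed
  qed measurable
qed

text \<open>A polynomial uniformly close to \<open>f\<close> on the unit interval converges by
  linearity of the moments. Both approximation errors are controlled by total mass, which is the
  moment of order 0. The map \<open>y\<close> expresses the limit as an image measure without
  forming it.\<close>

lemma method_of_moments:
  fixes w x :: "nat \<Rightarrow> nat \<Rightarrow> real" and u y :: "'a \<Rightarrow> real" and f :: "real \<Rightarrow> real"
  assumes w: "\<And>n j. w n j \<ge> 0" and sm: "\<And>n. summable (w n)" and x: "\<And>n j. x n j \<in> {0..1}"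
    and u: "integrable M u" "\<And>t. u t \<ge> 0"
    and y: "y \<in> borel_measurable M" "\<And>t. y t \<in> {0..1}"
    and moments: "\<And>k. (\<lambda>n. \<Sum>j. w n j * x n j ^ k) \<longlonglongrightarrow> (\<integral>t. u t * y t ^ k \<partial>M)"
    and f: "continuous_on UNIV f"
  shows "(\<lambda>n. \<Sum>j. w n j * f (x n j)) \<longlonglongrightarrow> (\<integral>t. u t * f (y t) \<partial>M)"
proof (rule LIMSEQ_I)
  fix e :: real assume "e > 0"
  have sm': "summable (\<lambda>j. w n j * g (x n j))" if contin: "continuous_on UNIV g" for n and g :: "real \<Rightarrow> real"
  proof -
    obtain B where B: "\<And>x. x \<in> {0..1} \<Longrightarrow> \<bar>g x\<bar> \<le> B"
      using bounded_on_unit_interval[OF contin] by blast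
    show ?thesis
    proof (rule summable_comparison_test')
      show "summable (\<lambda>j. w n j * B)" using sm by (rule summable_mult2)
      show "norm (w n j * g (x n j)) \<le> w n j * B" if "j \<ge> 0" for j
        using B[OF x] w by (auto simp: abs_mult intro!: mult_left_mono)
    qed
  qed
  define U where "U = integral\<^sup>L M u"
  have "U \<ge> 0" unfolding U_def using u(2) by simp
  \<comment> \<open>The three errors are \<open>(U + 1) * \<epsilon>\<close> for the sums,
    \<open>\<epsilon>\<close> for the polynomial and \<open>U * \<epsilon>\<close> for the
    integrals, in total \<open>(2 * U + 2) * \<epsilon>\<close>.\<close>
  define \<epsilon> where "\<epsilon> = e / (2 * U + 2)"
  have "\<epsilon> > 0" using \<open>e > 0\<close> \<open>U \<ge> 0\<close> by (simp add: \<epsilon>_def)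
  obtain g where g: "real_polynomial_function g" "\<And>x. x \<in> {0..1} \<Longrightarrow> \<bar>f x - g x\<bar> < \<epsilon>"
    using Stone_Weierstrass_real_polynomial_function[of "{0..1}" f \<epsilon>] f \<open>\<epsilon> > 0\<close>
    by (metis compact_Icc continuous_on_subset subset_UNIV)
  have contg: "continuous_on UNIV g"
    using g(1) by (simp add: continuous_on_polymonial_function real_polynomial_function_eq)
  obtain a N where a: "g = (\<lambda>x. \<Sum>i\<le>N. a i * x ^ i)"
    using g(1) real_polynomial_function_iff_sum by blast
  have "(\<lambda>n. \<Sum>i\<le>N. a i * (\<Sum>j. w n j * x n j ^ i)) \<longlonglongrightarrow>
      (\<Sum>i\<le>N. a i * (\<integral>t. u t * y t ^ i \<partial>M))"
    by (intro tendsto_intros moments)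
  also have "(\<lambda>n. \<Sum>i\<le>N. a i * (\<Sum>j. w n j * x n j ^ i)) = (\<lambda>n. \<Sum>j. w n j * g (x n j))"
  proof
    fix n
    have sm_i: "summable (\<lambda>j. w n j * x n j ^ i)" for i
      by (rule sm') (intro continuous_intros)
    have "(\<Sum>i\<le>N. a i * (\<Sum>j. w n j * x n j ^ i)) = (\<Sum>i\<le>N. \<Sum>j. a i * (w n j * x n j ^ i))"
      using sm_i by (simp add: suminf_mult)
    also have "\<dots> = (\<Sum>j. \<Sum>i\<le>N. a i * (w n j * x n j ^ i))"
      using sm_i by (intro suminf_sum [symmetric] summable_mult)
    finally show "(\<Sum>i\<le>N. a i * (\<Sum>j. w n j * x n j ^ i)) = (\<Sum>j. w n j * g (x n j))"
      unfolding a by (simp add: sum_distrib_left mult.left_commute)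
  qed
  also have "(\<Sum>i\<le>N. a i * (\<integral>t. u t * y t ^ i \<partial>M)) = (\<integral>t. u t * g (y t) \<partial>M)"
  proof -
    have "integrable M (\<lambda>t. u t * y t ^ i)" for i
      by (rule integrable_mult_continuous_compose[OF u(1) y, of "\<lambda>x. x ^ i"]) (intro continuous_intros)
    then have "(\<Sum>i\<le>N. a i * (\<integral>t. u t * y t ^ i \<partial>M)) = (\<integral>t. (\<Sum>i\<le>N. a i * (u t * y t ^ i)) \<partial>M)"
      by (subst Bochner_Integration.integral_sum) auto
    then show ?thesis unfolding a by (simp add: sum_distrib_left mult.left_commute)
  qed
  finally have "\<forall>\<^sub>F n in sequentially.
      dist (\<Sum>j. w n j * g (x n j)) (\<integral>t. u t * g (y t) \<partial>M) < \<epsilon>"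
    using \<open>\<epsilon> > 0\<close> by (rule tendstoD)
  moreover have "(\<lambda>n. \<Sum>j. w n j) \<longlonglongrightarrow> U"
    using moments[of 0] by (simp add: U_def)
  then have "\<forall>\<^sub>F n in sequentially. (\<Sum>j. w n j) < U + 1"
    by (elim order_tendstoD(2)) simp
  ultimately have "\<forall>\<^sub>F n in sequentially.
      norm ((\<Sum>j. w n j * f (x n j)) - (\<integral>t. u t * f (y t) \<partial>M)) < e"
  proof eventually_elim
    case (elim n)
    have "\<bar>(\<Sum>j. w n j * f (x n j)) - (\<Sum>j. w n j * g (x n j))\<bar> = \<bar>\<Sum>j. w n j * (f (x n j) - g (x n j))\<bar>"
      using sm'[OF f] sm'[OF contg] by (simp add: suminf_diff right_diff_distrib)
    also have "\<dots> \<le> (\<Sum>j. w n j * \<epsilon>)"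
    proof (rule norm_suminf_le[where 'a=real, simplified])
      show "summable (\<lambda>j. w n j * \<epsilon>)" using sm by (rule summable_mult2)
      show "\<bar>w n j * (f (x n j) - g (x n j))\<bar> \<le> w n j * \<epsilon>" for j
        using g(2)[OF x, of n j] w by (auto simp: abs_mult intro!: mult_left_mono)
    qed
    also have "\<dots> = (\<Sum>j. w n j) * \<epsilon>" using sm by (rule suminf_mult2 [symmetric])
    also have "\<dots> \<le> (U + 1) * \<epsilon>" using elim \<open>\<epsilon> > 0\<close> by (intro mult_right_mono) auto
    finally have 1: "\<bar>(\<Sum>j. w n j * f (x n j)) - (\<Sum>j. w n j * g (x n j))\<bar> \<le> (U + 1) * \<epsilon>" .
    have int: "integrable M (\<lambda>t. u t * f (y t))" "integrable M (\<lambda>t. u t * g (y t))"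
      using integrable_mult_continuous_compose[OF u(1) y] f contg by auto
    have "\<bar>(\<integral>t. u t * f (y t) \<partial>M) - (\<integral>t. u t * g (y t) \<partial>M)\<bar> = \<bar>\<integral>t. u t * (f (y t) - g (y t)) \<partial>M\<bar>"
      using int by (simp add: right_diff_distrib)
    also have "\<dots> \<le> (\<integral>t. \<bar>u t * (f (y t) - g (y t))\<bar> \<partial>M)"
      by (rule integral_abs_bound)
    also have "\<dots> \<le> (\<integral>t. u t * \<epsilon> \<partial>M)"
    proof (rule integral_mono)
      show "integrable M (\<lambda>t. \<bar>u t * (f (y t) - g (y t))\<bar>)"
        using int by (simp add: right_diff_distrib)
      show "\<bar>u t * (f (y t) - g (y t))\<bar> \<le> u t * \<epsilon>" for t
        using g(2)[OF y(2), of t] u(2)[of t] by (auto simp: abs_mult intro!: mult_left_mono)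
    qed (use u in simp)
    also have "\<dots> = U * \<epsilon>" by (simp add: U_def)
    finally have 2: "\<bar>(\<integral>t. u t * f (y t) \<partial>M) - (\<integral>t. u t * g (y t) \<partial>M)\<bar> \<le> U * \<epsilon>" .
    have "\<bar>(\<Sum>j. w n j * f (x n j)) - (\<integral>t. u t * f (y t) \<partial>M)\<bar> < (U + 1) * \<epsilon> + \<epsilon> + U * \<epsilon>"
      using 1 2 elim(1) unfolding dist_real_def by linarith
    also have "\<dots> = (2 * U + 2) * \<epsilon>" by (simp add: algebra_simps)
    also have "\<dots> = e" using \<open>U \<ge> 0\<close> by (simp add: \<epsilon>_def)
    finally show ?case by simp
  qed
  then show "\<exists>no. \<forall>n\<ge>no. norm ((\<Sum>j. w n j * f (x n j)) - (\<integral>t. u t * f (y t) \<partial>M)) < e"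
    by (simp add: eventually_sequentially)
qed

text \<open>The moments of the image of a measure under \<open>t \<mapsto> exp (- t)\<close> are its Laplace transform
  at the integers, so only integer arguments are needed.\<close>

lemma laplace_window:
  fixes r d :: "nat \<Rightarrow> real" and f :: "real \<Rightarrow> real"
  assumes r: "\<And>j. r j \<ge> 0" "\<And>j. r j \<le> B" and d: "\<And>n. d n \<ge> 0" and "\<alpha> > 0" "c \<ge> 0"
    and laplace: "\<And>k. k > 0 \<Longrightarrow> (\<lambda>n. d n * (\<Sum>j. r j * exp (- (real k / real n * real j))))
           \<longlonglongrightarrow> c * (Gamma \<alpha> * real k powr (- \<alpha>))"
    and f: "continuous_on UNIV f"
  shows "(\<lambda>n. \<Sum>j. d n * r j * exp (- (real j / real n)) * f (exp (- (real j / real n))))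
    \<longlonglongrightarrow> (\<integral>t. c * (indicator {0..} t * t powr (\<alpha> - 1) * exp (- t)) * f (exp (- \<bar>t\<bar>)) \<partial>lborel)"
proof -
  \<comment> \<open>One exponential factor goes into the weights and the density, making the masses
    finite. The moment of order \<open>k\<close> is then the Laplace transform at
    \<open>Suc k\<close>, which is positive even for \<open>k = 0\<close>.\<close>
  define u where "u t = c * (indicator {0..} t * t powr (\<alpha> - 1) * exp (- t))" for t :: real
  \<comment> \<open>The index is shifted because at \<open>n = 0\<close> division by zero would
    remove the exponential decay.\<close>
  define w where "w n j = d (Suc n) * r j * exp (- (real j / real (Suc n)))" for n j
  define x where "x n j = exp (- (real j / real (Suc n)))" for n j
  \<comment> \<open>The absolute value keeps \<open>exp (- \<bar>t\<bar>)\<close> in the unit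
    interval for negative \<open>t\<close>, where \<open>u\<close> vanishes anyway.\<close>
  have "(\<lambda>n. \<Sum>j. w n j * f (x n j)) \<longlonglongrightarrow> (\<integral>t. u t * f (exp (- \<bar>t\<bar>)) \<partial>lborel)"
  proof (rule method_of_moments[where w = w and x = x and u = u])
    show "w n j \<ge> 0" for n j using r d by (simp add: w_def)
    have sm: "summable (\<lambda>j. r j * exp (- (s * real j)))" if "s > 0" for s
      using r that by (intro summable_bounded_mult_exp[of _ B]) auto
    show "summable (w n)" for n
      using summable_mult[OF sm[of "1 / real (Suc n)"], of "d (Suc n)"]
      unfolding w_def by (simp add: mult.assoc)
    show "x n j \<in> {0..1}" for n j by (simp add: x_def)
    have "has_bochner_integral lborel u (c * (Gamma \<alpha> * 1 powr (- \<alpha>)))"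
      unfolding u_def using has_bochner_integral_Gamma[of \<alpha> 1] \<open>\<alpha> > 0\<close>
      by (intro has_bochner_integral_mult_right) auto
    then show "integrable lborel u" by (rule integrable.intros)
    show "u t \<ge> 0" for t using \<open>c \<ge> 0\<close> by (simp add: u_def)
    show "(\<lambda>n. \<Sum>j. w n j * x n j ^ k) \<longlonglongrightarrow> (\<integral>t. u t * exp (- \<bar>t\<bar>) ^ k \<partial>lborel)" for k
    proof -
      have "(\<Sum>j. w n j * x n j ^ k) =
          d (Suc n) * (\<Sum>j. r j * exp (- (real (Suc k) / real (Suc n) * real j)))" for n
      proof -
        have "w n j * x n j ^ k = d (Suc n) * (r j * exp (- (real (Suc k) / real (Suc n) * real j)))" for j
        proof -
          have "exp (- (real j / real (Suc n))) * x n j ^ k = exp (- (real j / real (Suc n))) ^ Suc k"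
            by (simp add: x_def)
          also have "\<dots> = exp (real (Suc k) * - (real j / real (Suc n)))"
            by (rule exp_of_nat_mult [symmetric])
          also have "\<dots> = exp (- (real (Suc k) / real (Suc n) * real j))"
            by simp
          finally have "exp (- (real j / real (Suc n))) * x n j ^ k
              = exp (- (real (Suc k) / real (Suc n) * real j))" .
          then show ?thesis by (simp add: w_def mult.assoc)
        qed
        moreover have "summable (\<lambda>j. r j * exp (- (real (Suc k) / real (Suc n) * real j)))"
          by (rule sm) simp
        ultimately show ?thesis by (simp add: suminf_mult)
      qed
      moreover have "(\<integral>t. u t * exp (- \<bar>t\<bar>) ^ k \<partial>lborel) = c * (Gamma \<alpha> * real (Suc k) powr (- \<alpha>))"
      proof -
        have "u t * exp (- \<bar>t\<bar>) ^ k =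
            c * (indicator {0..} t * t powr (\<alpha> - 1) * exp (- (real (Suc k) * t)))" for t
          by (simp add: u_def indicator_def algebra_simps flip: exp_of_nat_mult exp_add)
        moreover have "has_bochner_integral lborel
            (\<lambda>t. c * (indicator {0..} t * t powr (\<alpha> - 1) * exp (- (real (Suc k) * t))))
            (c * (Gamma \<alpha> * real (Suc k) powr (- \<alpha>)))"
          using \<open>\<alpha> > 0\<close> by (intro has_bochner_integral_mult_right has_bochner_integral_Gamma) auto
        ultimately show ?thesis by (simp only: has_bochner_integral_integral_eq)
      qed
      ultimately show ?thesis
        using LIMSEQ_Suc[OF laplace[of "Suc k"]] by (simp only: zero_less_Suc simp_thms)
    qed
  qed (use f in auto)
  then show ?thesis
    unfolding u_def w_def x_def
    by (rule filterlim_sequentially_Suc[THEN iffD1])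
qed

section \<open>From weak convergence to pointwise asymptotics of monotone sequences\<close>

lemma tendsto_geometric_laplace:
  assumes "s > 0"
  shows "(\<lambda>n. 1 / (real n * (1 - exp (- (s / real n))))) \<longlonglongrightarrow> 1 / s"
  unfolding divide_inverse[of 1 s] mult_1_left using assms by real_asymp

lemma suminf_exp_neg:
  fixes x :: real
  assumes "x > 0"
  shows "(\<Sum>j. exp (- (x * real j))) = 1 / (1 - exp (- x))"
proof -
  have "(\<lambda>j. exp (- (x * real j))) = (\<lambda>j. exp (- x) ^ j)"
    by (simp add: mult.commute flip: exp_of_nat_mult)
  then show ?thesis using assms by (simp add: suminf_geometric)
qed

lemma integral_pos_of_interval:
  fixes f :: "real \<Rightarrow> real"
  assumes "integrable lborel f" "\<And>t. f t \<ge> 0" "p < q" "\<And>t. p < t \<Longrightarrow> t < q \<Longrightarrow> f t \<noteq> 0"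
  shows "integral\<^sup>L lborel f > 0"
proof (rule ccontr)
  assume "\<not> integral\<^sup>L lborel f > 0"
  moreover have "integral\<^sup>L lborel f \<ge> 0" using assms(2) by simp
  ultimately have "AE t in lborel. f t = 0"
    using integral_nonneg_eq_0_iff_AE[OF assms(1)] assms(2) by auto
  then have "AE t in lborel. t \<notin> {p<..<q}"
    by eventually_elim (use assms(4) in auto)
  then have "emeasure lborel {p<..<q} = 0"
    by (subst (asm) AE_iff_null_sets [symmetric]) auto
  then show False using \<open>p < q\<close> by simp
qed

text \<open>Near \<open>j = n\<close>, but on one side only, monotonicity compares
  \<open>r j\<close> with \<open>r n\<close>. A bump \<open>h\<close> there turns the weak limit
  into a one-sided bound for \<open>real n * d n * r n\<close>, and shrinking the window to 1 closes
  the gap.\<close>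

lemma monotone_tauberian:
  fixes r d :: "nat \<Rightarrow> real"
  assumes r: "\<And>j. r j \<ge> 0" "decseq r" and d: "\<And>n. d n \<ge> 0" and \<alpha>: "0 < \<alpha>" "\<alpha> \<le> 1" and "c \<ge> 0"
    and laplace: "\<And>k. k > 0 \<Longrightarrow> (\<lambda>n. d n * (\<Sum>j. r j * exp (- (real k / real n * real j))))
           \<longlonglongrightarrow> c * (Gamma \<alpha> * real k powr (- \<alpha>))"
  shows "(\<lambda>n. real n * d n * r n) \<longlonglongrightarrow> c"
proof -
  \<comment> \<open>\<open>J\<close> is the limit of the bump sums weighted by
    \<open>d n * r j\<close>, and \<open>I\<close> the limit of the plain Riemann sums. Since
    \<open>\<alpha> \<le> 1\<close>, the density \<open>c * t powr (\<alpha> - 1)\<close> lies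
    between its endpoint values, so \<open>J / I\<close> is squeezed without computing
    either.\<close>
  have window: "\<exists>h I J. (\<forall>t. h t \<ge> 0) \<and> (\<forall>t. h t \<noteq> 0 \<longrightarrow> p < t \<and> t < q) \<and> I > 0 \<and>
      c * q powr (\<alpha> - 1) * I \<le> J \<and> J \<le> c * p powr (\<alpha> - 1) * I \<and>
      (\<lambda>n. \<Sum>j. d n * r j * h (real j / real n)) \<longlonglongrightarrow> J \<and>
      (\<lambda>n. \<Sum>j. 1 / real n * h (real j / real n)) \<longlonglongrightarrow> I"
    if pq: "0 < p" "p < q" for p q :: real
  proof -
    \<comment> \<open>A truncated quadratic in \<open>x = exp (- t)\<close>, positive exactly for
      \<open>p < t < q\<close>. The extra factor in \<open>h\<close> is the one built into
      \<open>laplace_window\<close>.\<close>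
    define f where "f x = max 0 ((x - exp (- q)) * (exp (- p) - x))" for x :: real
    define h where "h t = exp (- t) * f (exp (- t))" for t
    define u where "u a t = indicator {0..} t * t powr (a - 1) * exp (- t)" for a t :: real
    define I where "I = (\<integral>t. 1 * u 1 t * f (exp (- \<bar>t\<bar>)) \<partial>lborel)"
    define J where "J = (\<integral>t. c * u \<alpha> t * f (exp (- \<bar>t\<bar>)) \<partial>lborel)"
    have contf: "continuous_on UNIV f" unfolding f_def by (intro continuous_intros)
    have f_nonneg: "f x \<ge> 0" for x by (simp add: f_def)
    have f_nz: "f (exp (- t)) \<noteq> 0 \<longleftrightarrow> p < t \<and> t < q" for t
    proof -
      have "f (exp (- t)) \<noteq> 0 \<longleftrightarrow> (exp (- t) - exp (- q)) * (exp (- p) - exp (- t)) > 0"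
      proof -
        have "max 0 P \<noteq> 0 \<longleftrightarrow> P > 0" for P :: real by (auto simp: max_def)
        then show ?thesis unfolding f_def .
      qed
      then show ?thesis using pq by (auto simp: zero_less_mult_iff)
    qed
    have u_int: "integrable lborel (u a)" if "a > 0" for a
      using integrable.intros[OF has_bochner_integral_Gamma[of a 1]] that by (simp add: u_def[abs_def])
    have int: "integrable lborel (\<lambda>t. b * u a t * f (exp (- \<bar>t\<bar>)))" if "a > 0" for a b
      using u_int[OF that] contf
      by (intro integrable_mult_continuous_compose[of lborel "\<lambda>t. b * u a t" "\<lambda>t. exp (- \<bar>t\<bar>)" f]) auto
    have "(\<lambda>n. \<Sum>j. d n * r j * exp (- (real j / real n)) * f (exp (- (real j / real n)))) \<longlonglongrightarrow> J"
      unfolding J_def u_def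
      using r(2) by (intro laplace_window[OF r(1) _ d \<alpha>(1) \<open>c \<ge> 0\<close> laplace contf, where B = "r 0"])
        (auto simp: decseq_def)
    then have limJ: "(\<lambda>n. \<Sum>j. d n * r j * h (real j / real n)) \<longlonglongrightarrow> J"
      by (simp add: h_def mult.assoc)
    \<comment> \<open>The Riemann sums are the case of the constant sequence 1 with
      \<open>d n = 1 / real n\<close> and exponent 1, so the same weak limit applies.\<close>
    have "(\<lambda>n. \<Sum>j. 1 / real n * 1 * exp (- (real j / real n)) * f (exp (- (real j / real n)))) \<longlonglongrightarrow> I"
      unfolding I_def u_def
    proof (rule laplace_window[where B = 1])
      fix k :: nat assume k: "k > 0"
      have "(\<lambda>n. 1 / (real n * (1 - exp (- (real k / real n))))) \<longlonglongrightarrow> 1 / real k"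
        using k by (intro tendsto_geometric_laplace) simp
      moreover have "\<forall>\<^sub>F n in sequentially. 1 / (real n * (1 - exp (- (real k / real n)))) =
          1 / real n * (\<Sum>j. 1 * exp (- (real k / real n * real j)))"
        using eventually_gt_at_top[of 0]
      proof eventually_elim
        case (elim n)
        then have "real k / real n > 0" using k by simp
        from suminf_exp_neg[OF this] show ?case by simp
      qed
      ultimately have "(\<lambda>n. 1 / real n * (\<Sum>j. 1 * exp (- (real k / real n * real j)))) \<longlonglongrightarrow> 1 / real k"
        by (rule Lim_transform_eventually)
      then show "(\<lambda>n. 1 / real n * (\<Sum>j. 1 * exp (- (real k / real n * real j))))
          \<longlonglongrightarrow> 1 * (Gamma 1 * real k powr (- 1))"
        using k by (simp add: powr_minus divide_inverse)
    qed (use contf in auto)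
    then have limI: "(\<lambda>n. \<Sum>j. 1 / real n * h (real j / real n)) \<longlonglongrightarrow> I"
      by (simp add: h_def)
    have nz: "f (exp (- \<bar>t\<bar>)) \<noteq> 0 \<Longrightarrow> 0 \<le> t \<Longrightarrow> p < t \<and> t < q" for t
      using f_nz[of t] by simp
    have u_bounds: "c * q powr (\<alpha> - 1) * u 1 t \<le> c * u \<alpha> t" "c * u \<alpha> t \<le> c * p powr (\<alpha> - 1) * u 1 t"
      if "p < t" "t < q" for t
    proof -
      have "q powr (\<alpha> - 1) \<le> t powr (\<alpha> - 1)" "t powr (\<alpha> - 1) \<le> p powr (\<alpha> - 1)"
        using that pq \<alpha> by (auto intro!: powr_mono2')
      then show "c * q powr (\<alpha> - 1) * u 1 t \<le> c * u \<alpha> t" "c * u \<alpha> t \<le> c * p powr (\<alpha> - 1) * u 1 t"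
        using that pq \<open>c \<ge> 0\<close> by (auto simp: u_def mult.assoc intro!: mult_left_mono mult_right_mono)
    qed
    have u_neg: "u a t = 0" if "\<not> 0 \<le> t" for a t
      using that by (simp add: u_def)
    have "I > 0" unfolding I_def
    proof (rule integral_pos_of_interval)
      show "1 * u 1 t * f (exp (- \<bar>t\<bar>)) \<noteq> 0" if "p < t" "t < q" for t
        using that pq f_nz[of t] by (simp add: u_def)
      show "1 * u 1 t * f (exp (- \<bar>t\<bar>)) \<ge> 0" for t
        using f_nonneg by (simp add: u_def)
    qed (use int[of 1 1] pq in auto)
    moreover have "c * q powr (\<alpha> - 1) * I \<le> J"
    proof -
      have "c * q powr (\<alpha> - 1) * I = (\<integral>t. (c * q powr (\<alpha> - 1)) * u 1 t * f (exp (- \<bar>t\<bar>)) \<partial>lborel)"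
        unfolding I_def by (simp add: mult.assoc)
      also have "\<dots> \<le> J"
        unfolding J_def
      proof (rule integral_mono)
        fix t :: real
        show "c * q powr (\<alpha> - 1) * u 1 t * f (exp (- \<bar>t\<bar>)) \<le> c * u \<alpha> t * f (exp (- \<bar>t\<bar>))"
          using u_bounds(1)[of t] nz[of t] u_neg[of t] f_nonneg
          by (cases "t \<ge> 0"; cases "f (exp (- \<bar>t\<bar>)) = 0") (auto intro: mult_right_mono)
      qed (use int \<alpha> in auto)
      finally show ?thesis .
    qed
    moreover have "J \<le> c * p powr (\<alpha> - 1) * I"
    proof -
      have "J \<le> (\<integral>t. (c * p powr (\<alpha> - 1)) * u 1 t * f (exp (- \<bar>t\<bar>)) \<partial>lborel)"
        unfolding J_def
      proof (rule integral_mono)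
        fix t :: real
        show "c * u \<alpha> t * f (exp (- \<bar>t\<bar>)) \<le> c * p powr (\<alpha> - 1) * u 1 t * f (exp (- \<bar>t\<bar>))"
          using u_bounds(2)[of t] nz[of t] u_neg[of t] f_nonneg
          by (cases "t \<ge> 0"; cases "f (exp (- \<bar>t\<bar>)) = 0") (auto intro: mult_right_mono)
      qed (use int \<alpha> in auto)
      also have "\<dots> = c * p powr (\<alpha> - 1) * I"
        unfolding I_def by (simp add: mult.assoc)
      finally show ?thesis .
    qed
    moreover have "h t \<ge> 0" "h t \<noteq> 0 \<longrightarrow> p < t \<and> t < q" for t
      using f_nonneg f_nz[of t] by (auto simp: h_def)
    ultimately show ?thesis using limI limJ by blast
  qed
  have summ: "summable (\<lambda>j. g j * h (real j / real n))"
    if "\<forall>t. h t \<noteq> 0 \<longrightarrow> p < t \<and> t < q" "n > 0" for g h :: "_ \<Rightarrow> real" and p q and n :: nat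
  proof (rule summable_finite[of "{..nat \<lceil>q * real n\<rceil>}"])
    fix j assume "j \<notin> {..nat \<lceil>q * real n\<rceil>}"
    then have "q * real n \<le> real j" by (simp add: le_nat_iff) linarith
    then have "\<not> real j / real n < q" using \<open>n > 0\<close> by (simp add: field_simps)
    then show "g j * h (real j / real n) = 0" using that(1) by auto
  qed simp
  show ?thesis
  proof (rule order_tendstoI)
    fix y assume "y < c"
    \<comment> \<open>Lower bound: choose \<open>b > 1\<close> so close to 1 that the smallest
      density on the window \<open>(1, b)\<close> still exceeds \<open>y\<close>. On its support
      \<open>j \<ge> n\<close>, hence \<open>r j \<le> r n\<close>.\<close>
    have "((\<lambda>b. c * b powr (\<alpha> - 1)) \<longlongrightarrow> c * 1 powr (\<alpha> - 1)) (at_right 1)"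
      by (intro tendsto_intros) auto
    then have "\<forall>\<^sub>F b in at_right 1. y < c * b powr (\<alpha> - 1)"
      using \<open>y < c\<close> by (intro order_tendstoD(1)) auto
    then have "\<forall>\<^sub>F b in at_right (1::real). y < c * b powr (\<alpha> - 1) \<and> 1 < b"
      using eventually_at_right_less by (rule eventually_conj)
    then obtain b :: real where b: "y < c * b powr (\<alpha> - 1)" "1 < b"
      using eventually_happens'[OF trivial_limit_at_right_real] by blast
    from window[of 1 b] b(2) obtain h I J where
      h: "\<forall>t. h t \<ge> 0" "\<forall>t. h t \<noteq> 0 \<longrightarrow> 1 < t \<and> t < b" and I: "I > 0"
      and J: "c * b powr (\<alpha> - 1) * I \<le> J"
      and lims: "(\<lambda>n. \<Sum>j. d n * r j * h (real j / real n)) \<longlonglongrightarrow> J"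
        "(\<lambda>n. \<Sum>j. 1 / real n * h (real j / real n)) \<longlonglongrightarrow> I" by auto
    have "y < J / I"
      using less_le_trans[OF mult_strict_right_mono[OF b(1) I] J] I by (simp add: pos_less_divide_eq)
    then have "\<forall>\<^sub>F n in sequentially. y < (\<Sum>j. d n * r j * h (real j / real n)) /
        (\<Sum>j. 1 / real n * h (real j / real n))"
      using lims I by (intro order_tendstoD(1)[OF tendsto_divide]) auto
    moreover have "\<forall>\<^sub>F n in sequentially. 0 < (\<Sum>j. 1 / real n * h (real j / real n))"
      using order_tendstoD(1)[OF lims(2) I] .
    ultimately show "\<forall>\<^sub>F n in sequentially. y < real n * d n * r n"
      using eventually_gt_at_top[of 0]
    proof eventually_elim
      case (elim n)
      have "(\<Sum>j. d n * r j * h (real j / real n))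
          \<le> (\<Sum>j. real n * d n * r n * (1 / real n * h (real j / real n)))"
      proof (rule suminf_le)
        fix j
        have "r j \<le> r n" if "h (real j / real n) \<noteq> 0"
        proof -
          have "n \<le> j" using h(2)[rule_format, OF that] elim(3) by (simp add: field_simps)
          then show ?thesis using r(2) by (simp add: decseq_def)
        qed
        then have "r j * h (real j / real n) \<le> r n * h (real j / real n)"
          using h(1) by (cases "h (real j / real n) = 0") (auto intro: mult_right_mono)
        then have "d n * (r j * h (real j / real n)) \<le> d n * (r n * h (real j / real n))"
          using d by (intro mult_left_mono) auto
        then show "d n * r j * h (real j / real n) \<le> real n * d n * r n * (1 / real n * h (real j / real n))"
          using elim(3) by (simp add: mult.assoc)
      next
        show "summable (\<lambda>j. real n * d n * r n * (1 / real n * h (real j / real n)))"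
          by (rule summable_mult, rule summ[OF h(2) elim(3)])
      qed (rule summ[OF h(2) elim(3)])
      also have "\<dots> = real n * d n * r n * (\<Sum>j. 1 / real n * h (real j / real n))"
        by (intro suminf_mult summ[OF h(2) elim(3)])
      finally have "(\<Sum>j. d n * r j * h (real j / real n)) / (\<Sum>j. 1 / real n * h (real j / real n))
          \<le> real n * d n * r n"
        using elim(2) by (simp add: pos_divide_le_eq)
      with elim(1) show ?case by linarith
    qed
  next
    fix y assume "c < y"
    \<comment> \<open>Upper bound: the window \<open>(b, 1)\<close> lies left of 1, so
      \<open>j \<le> n\<close> and the comparison with \<open>r n\<close> reverses.\<close>
    have "((\<lambda>b. c * b powr (\<alpha> - 1)) \<longlongrightarrow> c * 1 powr (\<alpha> - 1)) (at_left 1)"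
      by (intro tendsto_intros) auto
    then have "\<forall>\<^sub>F b in at_left 1. c * b powr (\<alpha> - 1) < y"
      using \<open>c < y\<close> by (intro order_tendstoD(2)) auto
    then have "\<forall>\<^sub>F b in at_left (1::real). c * b powr (\<alpha> - 1) < y \<and> b \<in> {0<..<1}"
      using eventually_at_left_real[of 0 1] by (intro eventually_conj) auto
    then obtain b :: real where b: "c * b powr (\<alpha> - 1) < y" "0 < b" "b < 1"
      using eventually_happens'[OF trivial_limit_at_left_real] by force
    from window[of b 1] b(2,3) obtain h I J where
      h: "\<forall>t. h t \<ge> 0" "\<forall>t. h t \<noteq> 0 \<longrightarrow> b < t \<and> t < 1" and I: "I > 0"
      and J: "J \<le> c * b powr (\<alpha> - 1) * I"
      and lims: "(\<lambda>n. \<Sum>j. d n * r j * h (real j / real n)) \<longlonglongrightarrow> J"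
        "(\<lambda>n. \<Sum>j. 1 / real n * h (real j / real n)) \<longlonglongrightarrow> I" by auto
    have "J / I < y"
      using le_less_trans[OF J mult_strict_right_mono[OF b(1) I]] I by (simp add: pos_divide_less_eq)
    then have "\<forall>\<^sub>F n in sequentially. (\<Sum>j. d n * r j * h (real j / real n)) /
        (\<Sum>j. 1 / real n * h (real j / real n)) < y"
      using lims I by (intro order_tendstoD(2)[OF tendsto_divide]) auto
    moreover have "\<forall>\<^sub>F n in sequentially. 0 < (\<Sum>j. 1 / real n * h (real j / real n))"
      using order_tendstoD(1)[OF lims(2) I] .
    ultimately show "\<forall>\<^sub>F n in sequentially. real n * d n * r n < y"
      using eventually_gt_at_top[of 0]
    proof eventually_elim
      case (elim n)
      have "real n * d n * r n * (\<Sum>j. 1 / real n * h (real j / real n)) =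
          (\<Sum>j. real n * d n * r n * (1 / real n * h (real j / real n)))"
        by (intro suminf_mult [symmetric] summ[OF h(2) elim(3)])
      also have "\<dots> \<le> (\<Sum>j. d n * r j * h (real j / real n))"
      proof (rule suminf_le)
        fix j
        have "r n \<le> r j" if "h (real j / real n) \<noteq> 0"
        proof -
          have "j \<le> n" using h(2)[rule_format, OF that] elim(3) by (simp add: field_simps)
          then show ?thesis using r(2) by (simp add: decseq_def)
        qed
        then have "r n * h (real j / real n) \<le> r j * h (real j / real n)"
          using h(1) by (cases "h (real j / real n) = 0") (auto intro: mult_right_mono)
        then have "d n * (r n * h (real j / real n)) \<le> d n * (r j * h (real j / real n))"
          using d by (intro mult_left_mono) auto
        then show "real n * d n * r n * (1 / real n * h (real j / real n)) \<le> d n * r j * h (real j / real n)"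
          using elim(3) by (simp add: mult.assoc)
      next
        show "summable (\<lambda>j. real n * d n * r n * (1 / real n * h (real j / real n)))"
          by (rule summable_mult, rule summ[OF h(2) elim(3)])
      qed (rule summ[OF h(2) elim(3)])
      finally have "real n * d n * r n
          \<le> (\<Sum>j. d n * r j * h (real j / real n)) / (\<Sum>j. 1 / real n * h (real j / real n))"
        using elim(2) by (simp add: pos_le_divide_eq)
      with elim(1) show ?case by linarith
    qed
  qed
qed

section \<open>Asymptotics of the resolvent\<close>

text \<open>Restriction of the complex reflection formula. At integers one Gamma value sits at a
  pole and is 0 by convention, in agreement with \<open>pi / 0 = 0\<close>.\<close>

lemma Gamma_reflection_real:
  "Gamma \<alpha> * Gamma (1 - \<alpha>) = pi / sin (\<alpha> * pi :: real)"
proof -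
  have "complex_of_real (Gamma \<alpha> * Gamma (1 - \<alpha>)) =
      Gamma (complex_of_real \<alpha>) * Gamma (1 - complex_of_real \<alpha>)"
    using Gamma_complex_of_real[of \<alpha>] Gamma_complex_of_real[of "1 - \<alpha>"] by simp
  also have "\<dots> = complex_of_real pi / sin (complex_of_real (pi * \<alpha>))"
    by (simp add: Gamma_reflection_complex)
  also have "\<dots> = complex_of_real (pi / sin (\<alpha> * pi))"
    unfolding sin_of_real by (simp add: mult.commute)
  finally show ?thesis by (simp only: of_real_eq_iff)
qed

lemma regularly_varying_convolution_inverse:
  fixes lam r :: "nat \<Rightarrow> real"
  assumes rv: "regularly_varying lam (-\<alpha>)" and dec: "decseq lam" and \<alpha>: "0 < \<alpha>" "\<alpha> < 1"
    and r: "\<And>j. r j \<ge> 0" "decseq r"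
    and conv: "\<And>n. (\<Sum>i\<le>n. r i * lam (n - i)) = 1"
  shows "(\<lambda>n. real n * lam n * r n) \<longlonglongrightarrow> sin (\<alpha> * pi) / pi"
proof (rule monotone_tauberian)
  have pos: "lam n > 0" for n using rv by (auto simp: regularly_varying_def)
  have sm: "summable (\<lambda>j. lam j * exp (- (x * real j)))" "summable (\<lambda>j. r j * exp (- (x * real j)))"
    if "x > 0" for x
  proof -
    show "summable (\<lambda>j. lam j * exp (- (x * real j)))"
      using pos dec that
      by (intro summable_bounded_mult_exp[of _ "lam 0"]) (auto simp: decseq_def abs_of_pos)
    show "summable (\<lambda>j. r j * exp (- (x * real j)))"
      using r that by (intro summable_bounded_mult_exp[of _ "r 0"]) (auto simp: decseq_def)
  qed
  \<comment> \<open>The Cauchy product turns the convolution, which is constantly 1, into a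
    geometric series.\<close>
  have prod: "(\<Sum>j. r j * exp (- (x * real j))) * (\<Sum>j. lam j * exp (- (x * real j))) =
      1 / (1 - exp (- x))" if "x > 0" for x
  proof -
    have "(\<lambda>k. \<Sum>i\<le>k. (r i * exp (- (x * real i))) * (lam (k - i) * exp (- (x * real (k - i)))))
        sums ((\<Sum>j. r j * exp (- (x * real j))) * (\<Sum>j. lam j * exp (- (x * real j))))"
      using sm[OF that] pos r by (intro Cauchy_product_sums) (simp_all add: abs_mult abs_of_pos)
    moreover have "(\<Sum>i\<le>k. (r i * exp (- (x * real i))) * (lam (k - i) * exp (- (x * real (k - i)))))
        = exp (- (x * real k))" for k
    proof -
      have "(r i * exp (- (x * real i))) * (lam (k - i) * exp (- (x * real (k - i)))) =
          r i * lam (k - i) * exp (- (x * real k))" if "i \<le> k" for i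
        using that by (simp add: of_nat_diff algebra_simps flip: exp_add)
      then have "(\<Sum>i\<le>k. (r i * exp (- (x * real i))) * (lam (k - i) * exp (- (x * real (k - i)))))
          = (\<Sum>i\<le>k. r i * lam (k - i)) * exp (- (x * real k))"
        unfolding sum_distrib_right by (intro sum.cong) auto
      then show ?thesis by (simp add: conv)
    qed
    ultimately show ?thesis
      using suminf_exp_neg[OF that] by (simp add: sums_iff)
  qed
  show "(\<lambda>n. lam n * (\<Sum>j. r j * exp (- (real k / real n * real j))))
      \<longlonglongrightarrow> sin (\<alpha> * pi) / pi * (Gamma \<alpha> * real k powr (- \<alpha>))" if k: "k > 0" for k :: nat
  proof -
    define S where "S n = (\<Sum>j. lam j * exp (- (real k / real n * real j)))" for n
    have G: "Gamma (1 - \<alpha>) > 0" "Gamma \<alpha> > 0" using \<alpha> by (auto intro: Gamma_real_pos)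
    \<comment> \<open>Dividing the asymptotics of the geometric series by those of \<open>S\<close>
      cancels the factors \<open>real n\<close> and isolates the transform of \<open>r\<close>,
      scaled by \<open>lam n\<close>.\<close>
    have "(\<lambda>n. 1 / (real n * (1 - exp (- (real k / real n)))) / (S n / (real n * lam n)))
        \<longlonglongrightarrow> (1 / real k) / (Gamma (1 - \<alpha>) * real k powr (\<alpha> - 1))"
      unfolding S_def using k G
      by (intro tendsto_divide tendsto_geometric_laplace abelian_regularly_varying[OF rv dec \<alpha>]) auto
    moreover have "\<forall>\<^sub>F n in sequentially.
        1 / (real n * (1 - exp (- (real k / real n)))) / (S n / (real n * lam n)) =
        lam n * (\<Sum>j. r j * exp (- (real k / real n * real j)))"
      using eventually_gt_at_top[of 0]
    proof eventually_elim
      case (elim n)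
      have x: "real k / real n > 0" using k elim by simp
      have "S n > 0" unfolding S_def
        using pos by (intro suminf_pos sm(1)[OF x]) simp
      define R where "R = (\<Sum>j. r j * exp (- (real k / real n * real j)))"
      have "1 / (1 - exp (- (real k / real n))) = R * S n"
        using prod[OF x] by (simp add: S_def R_def)
      then have "1 / (real n * (1 - exp (- (real k / real n)))) = R * S n / real n"
        by (simp add: divide_inverse)
      then show ?case
        unfolding R_def[symmetric] using \<open>S n > 0\<close> elim pos[of n] by simp
    qed
    ultimately have "(\<lambda>n. lam n * (\<Sum>j. r j * exp (- (real k / real n * real j))))
        \<longlonglongrightarrow> (1 / real k) / (Gamma (1 - \<alpha>) * real k powr (\<alpha> - 1))"
      by (rule Lim_transform_eventually)
    also have "(1 / real k) / (Gamma (1 - \<alpha>) * real k powr (\<alpha> - 1)) =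
        1 / Gamma (1 - \<alpha>) * real k powr (- \<alpha>)"
      using k by (simp add: powr_diff powr_minus field_simps)
    also have "1 / Gamma (1 - \<alpha>) = sin (\<alpha> * pi) / pi * Gamma \<alpha>"
    proof -
      have "sin (\<alpha> * pi) > 0" using \<alpha> by (intro sin_gt_zero) auto
      then show ?thesis using Gamma_reflection_real[of \<alpha>] G by (simp add: field_simps)
    qed
    finally show ?thesis by (simp add: mult.assoc)
  qed
  show "sin (\<alpha> * pi) / pi \<ge> 0" using \<alpha> by (intro divide_nonneg_pos sin_ge_zero) auto
  show "lam n \<ge> 0" for n using pos[of n] by simp
qed (use \<alpha> r in auto)

theorem theorem4p1:
  fixes k L :: "nat \<Rightarrow> real" and a \<alpha> :: real
  assumes kpos: "\<And>n. n \<ge> 1 \<Longrightarrow> k n > 0"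
    and ksum: "summable k"
    and ksum_le: "(\<Sum>j. k (Suc j)) \<le> 1"
    and a_def: "a = - (\<Sum>j. k (Suc j))"
    and C2: "\<And>n. n \<ge> 1 \<Longrightarrow>
               (tail_lam k n)\<^sup>2 \<le> tail_lam k (n - 1) * tail_lam k (n + 1)"
    and alpha: "0 < \<alpha>" "\<alpha> < 1"
    and L_sv: "slowly_varying L"
    and C3: "\<And>n. n \<ge> 1 \<Longrightarrow> tail_lam k n = L n * real n powr (- \<alpha>)"
  shows "(\<lambda>n. real n powr (1 - \<alpha>) * L n * resolvent a k n)
           \<longlonglongrightarrow> sin (\<alpha> * pi) / pi"
proof -
  define lam where "lam = tail_lam k"
  define r where "r = resolvent a k"
  have lam0: "lam 0 = 1" by (simp add: lam_def tail_lam_def)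
  \<comment> \<open>The first decrement \<open>lam 0 - lam 1\<close> is thus \<open>1 + a\<close>,
    the coefficient of \<open>r n\<close> in the resolvent equation. It is nonnegative by
    \<open>ksum_le\<close>; all later decrements are the \<open>k n\<close>.\<close>
  have lam1: "lam (Suc 0) = - a" by (simp add: lam_def tail_lam_def a_def)
  have sm: "summable (\<lambda>j. k (j + n))" for n using ksum by (simp add: summable_iff_shift)
  have pos: "lam n > 0" for n
    using kpos by (auto simp: lam_def tail_lam_def intro!: suminf_pos sm)
  have diff: "lam n - lam (Suc n) = k n" if "n \<ge> 1" for n
    using that suminf_split_head[OF sm[of n]] by (simp add: lam_def tail_lam_def)
  have "lam (Suc n) \<le> lam n" for n
  proof (cases n)
    case 0
    then show ?thesis using lam0 lam1 ksum_le a_def by simp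
  next
    case (Suc m)
    then show ?thesis using diff[of n] kpos[of n] by simp
  qed
  then have dec: "decseq lam" by (rule decseq_SucI)
  have kaluza: "(lam (Suc n))\<^sup>2 \<le> lam n * lam (Suc (Suc n))" for n
    using C2[of "Suc n"] by (simp add: lam_def)
  have r0: "r 0 = 1" by (simp add: r_def)
  have "r (Suc n) = (\<Sum>j\<le>n. (lam j - lam (Suc j)) * r (n - j))" for n
  proof -
    have "(\<Sum>j\<le>n. (lam j - lam (Suc j)) * r (n - j)) =
        (lam 0 - lam (Suc 0)) * r n + (\<Sum>j=1..n. (lam j - lam (Suc j)) * r (n - j))"
      by (simp add: atMost_atLeast0 sum.atLeast_Suc_atMost)
    also have "(\<Sum>j=1..n. (lam j - lam (Suc j)) * r (n - j)) = (\<Sum>j=1..n. k j * r (n - j))"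
      by (intro sum.cong) (auto simp: diff)
    finally show ?thesis by (simp add: r_def lam0 lam1 algebra_simps)
  qed
  then have "(\<Sum>j\<le>n. lam j * r (n - j)) = 1" for n
    by (rule convolution_eq_one[of lam r, OF lam0 r0])
  moreover have "(\<Sum>i\<le>n. r i * lam (n - i)) = (\<Sum>j\<le>n. lam j * r (n - j))" for n
    by (rule sum.reindex_bij_witness[of _ "\<lambda>i. n - i" "\<lambda>i. n - i"]) auto
  ultimately have conv: "(\<Sum>i\<le>n. r i * lam (n - i)) = 1" for n
    by simp
  have r_dec: "decseq r" by (rule kaluza_decseq[of lam, OF lam0 r0 pos kaluza conv])
  have r_nonneg: "r n \<ge> 0" for n by (rule kaluza_nonneg[of r lam, OF r0 pos dec r_dec conv])
  have rv: "regularly_varying lam (-\<alpha>)"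
    unfolding regularly_varying_def
  proof (intro conjI allI impI pos)
    fix l :: real assume l: "l > 0"
    have "(\<lambda>n. L (nat \<lfloor>l * real n\<rfloor>) / L n) \<longlonglongrightarrow> l powr 0"
      using L_sv l by (auto simp: slowly_varying_def regularly_varying_def)
    then have "(\<lambda>n. L (nat \<lfloor>l * real n\<rfloor>) / L n * (real (nat \<lfloor>l * real n\<rfloor>) / real n) powr (- \<alpha>))
        \<longlonglongrightarrow> l powr 0 * l powr (- \<alpha>)"
      using l by (intro tendsto_mult tendsto_powr tendsto_floor_over tendsto_const) auto
    \<comment> \<open>From here on the integer part of \<open>l * real n\<close> is at least 1. This
      matters because \<open>C3\<close> says nothing about index 0, where \<open>lam\<close> is 1 by
      definition.\<close>
    moreover have "\<forall>\<^sub>F n in sequentially. real n \<ge> 1 / l"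
      by real_asymp
    then have "\<forall>\<^sub>F n in sequentially.
        L (nat \<lfloor>l * real n\<rfloor>) / L n * (real (nat \<lfloor>l * real n\<rfloor>) / real n) powr (- \<alpha>) =
        lam (nat \<lfloor>l * real n\<rfloor>) / lam n"
      using eventually_gt_at_top[of 0]
    proof eventually_elim
      case (elim n)
      have "l * real n \<ge> 1" using elim l by (simp add: field_simps)
      then have "nat \<lfloor>l * real n\<rfloor> \<ge> 1" by linarith
      then show ?case
        using elim by (simp add: lam_def C3 powr_divide)
    qed
    ultimately have "(\<lambda>n. lam (nat \<lfloor>l * real n\<rfloor>) / lam n) \<longlonglongrightarrow> l powr 0 * l powr (- \<alpha>)"
      by (rule Lim_transform_eventually)
    then show "(\<lambda>n. lam (nat \<lfloor>l * real n\<rfloor>) / lam n) \<longlonglongrightarrow> l powr (- \<alpha>)"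
      using l by simp
  qed
  have "(\<lambda>n. real n * lam n * r n) \<longlonglongrightarrow> sin (\<alpha> * pi) / pi"
    by (rule regularly_varying_convolution_inverse[OF rv dec alpha r_nonneg r_dec conv])
  moreover have "\<forall>\<^sub>F n in sequentially.
      real n * lam n * r n = real n powr (1 - \<alpha>) * L n * resolvent a k n"
    using eventually_gt_at_top[of 0]
    by eventually_elim (simp add: lam_def r_def C3 powr_diff powr_minus field_simps)
  ultimately show ?thesis by (rule Lim_transform_eventually)
qed

end
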